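(* Let $n\ge 2$ be an integer. Over the class of all complete bipartite graphs on $n$ vertices, the number of acyclic orientations is maximised by a graph $K_{n_1,n_2}$ (with $n_1+n_2=n$) for which $|n_1-n_2|\le 1$, namely the Tur\'an graph $T_2(n)=K_{\lfloor n/2\rfloor,\lceil n/2\rceil}$. Moreover, the sequence $a(K_{k,n-k})$, $k=1,2,\dots,n-1$, is unimodal.
   Context: An acyclic orientation of a graph $G$ is an assignment of a direction to each edge of $G$ such that the resulting directed graph has no directed cycles; $a(G)$ denotes the number of acyclic orientations of $G$. $K_{p,q}$ is the complete bipartite graph with parts of sizes $p,q\ge 1$. A finite sequence $x_0,\dots,x_N$ is unimodal if there is some $0\le k\le N$ such that $x_0\le x_1\le\dots\le x_k\ge x_{k+1}\ge\dots\ge x_N$ (and similarly for a sequence indexed by another finite interval of integers). *)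

theory Defs
  imports Complex_Main "Graph_Theory.Kuratowski"
begin

text \<open>
  Finite simple graphs are the library's \<open>graph\<close>s, i.e. finite loopless symmetric digraphs without
  multiple arcs: an undirected edge \<open>uv\<close> is the pair of ends \<open>(u,v)\<close>, \<open>(v,u)\<close>. An orientation keeps
  exactly one of the two.
\<close>

definition orientation :: "('a, 'b) pre_digraph \<Rightarrow> ('a \<times> 'a) set \<Rightarrow> bool" where
  "orientation G A \<longleftrightarrow> A \<subseteq> arcs_ends G \<and>
     (\<forall>(u, v) \<in> arcs_ends G. (u, v) \<in> A \<longleftrightarrow> (v, u) \<notin> A)"

definition acyclic_orientations :: "('a, 'b) pre_digraph \<Rightarrow> ('a \<times> 'a) set set" where
  "acyclic_orientations G = {A. orientation G A \<and> acyclic A}"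

definition num_acyclic_orientations :: "('a, 'b) pre_digraph \<Rightarrow> nat" where
  "num_acyclic_orientations G = card (acyclic_orientations G)"

text \<open>
  The library's \<open>complete_bipartite_digraph p q G\<close> says that \<open>G\<close> is a complete bipartite graph with
  parts of sizes \<open>p\<close> and \<open>q\<close>; it permits empty parts, which are excluded here.
\<close>

definition complete_bipartite_on :: "nat \<Rightarrow> ('a, 'b) pre_digraph \<Rightarrow> bool" where
  "complete_bipartite_on n G \<longleftrightarrow>
     (\<exists>p q. 1 \<le> p \<and> 1 \<le> q \<and> p + q = n \<and> complete_bipartite_digraph p q G)"

text \<open>A concrete representative of the isomorphism class of \<open>K\<^bsub>p,q\<^esub>\<close>.\<close>

definition K_bip :: "nat \<Rightarrow> nat \<Rightarrow> (nat + nat, (nat + nat) \<times> (nat + nat)) pre_digraph" where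
  "K_bip p q = (let U = Inl ` {..<p}; V = Inr ` {..<q} in
     \<lparr>verts = U \<union> V, arcs = U \<times> V \<union> V \<times> U, tail = fst, head = snd\<rparr>)"

lemma complete_bipartite_K_bip: "complete_bipartite_digraph p q (K_bip p q)"
proof -
  let ?U = "Inl ` {..<p} :: (nat + nat) set" and ?V = "Inr ` {..<q} :: (nat + nat) set"
  have ends: "arcs_ends (K_bip p q) = ?U \<times> ?V \<union> ?V \<times> ?U"
    by (simp add: K_bip_def Let_def arcs_ends_conv)
  have "sym (arcs_ends (K_bip p q))"
    unfolding ends by (auto intro!: symI)
  then have "graph (K_bip p q)"
    by unfold_locales
       (auto simp: K_bip_def Let_def arc_to_ends_def symmetric_def)
  moreover have "verts (K_bip p q) = ?U \<union> ?V" "?U \<inter> ?V = {}" "card ?U = p" "card ?V = q"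
    by (auto simp: K_bip_def Let_def card_image)
  ultimately show ?thesis
    unfolding complete_bipartite_digraph_def using ends by blast
qed

definition turan2 :: "nat \<Rightarrow> (nat + nat, (nat + nat) \<times> (nat + nat)) pre_digraph" where
  "turan2 n = K_bip (nat \<lfloor>real n / 2\<rfloor>) (nat \<lceil>real n / 2\<rceil>)"

text \<open>Unimodality of the finite sequence \<open>x a, \<dots>, x b\<close>.\<close>

definition unimodal_on :: "nat \<Rightarrow> nat \<Rightarrow> (nat \<Rightarrow> 'a::order) \<Rightarrow> bool" where
  "unimodal_on a b x \<longleftrightarrow> (\<exists>k. a \<le> k \<and> k \<le> b \<and>
     (\<forall>i. a \<le> i \<and> i < k \<longrightarrow> x i \<le> x (Suc i)) \<and>
     (\<forall>i. k \<le> i \<and> i < b \<longrightarrow> x (Suc i) \<le> x i))"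

end

theory Submission
  imports Defs "HOL-Combinatorics.Stirling" "HOL-Library.Infinite_Set" "HOL-Library.FuncSet"
begin

text \<open>
  The proof counts the acyclic orientations of \<open>K\<^bsub>p,q\<^esub>\<close> exactly and then compares neighbouring
  parameters by total positivity.

  Counting. In an orientation of the complete bipartite graph on \<open>U\<close> and \<open>V\<close>, two vertices of
  \<open>U\<close> with incomparable in-neighbourhoods lie on a directed 4-cycle. Hence in an acyclic orientation
  the in-neighbourhoods of the vertices of \<open>U\<close> form a chain of subsets of \<open>V\<close>, and the orientation
  amounts to an ordered sequence of blocks \<open>V\<^sub>0, U\<^sub>0, V\<^sub>1, U\<^sub>1, \<dots>, V\<^sub>m, U\<^sub>m\<close> partitioning
  \<open>U\<close> and \<open>V\<close>, where every edge points to the later block and only the two outermost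
  blocks \<open>V\<^sub>0\<close> and \<open>U\<^sub>m\<close> may be empty. This sequence is determined by the orientation. The blocks of a
  \<open>p\<close>-element side can be chosen in \<open>s p m = m! S(p + 1, m + 1)\<close> ways, \<open>S\<close> being the Stirling
  numbers of the second kind (definition \<open>num_covering\<close>), so that
  \<open>a(K\<^bsub>p,q\<^esub>) = (\<Sum>m. s p m * s q m)\<close> (lemma \<open>num_acyclic_orientations_bipartite\<close>).

  Comparison. The recurrence \<open>s (p + 1) m = (m + 1) * s p m + m * s p (m - 1)\<close> makes the diagonal
  contributions cancel in
  \<open>a(K\<^bsub>p+1,q\<^esub>) - a(K\<^bsub>p,q+1\<^esub>) = (\<Sum>m. m * (s p (m - 1) * s q m - s p m * s q (m - 1)))\<close>.
  The right-hand side is a combination of 2x2 minors of the array \<open>s\<close>, which are all nonnegative for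
  \<open>p \<le> q\<close> (lemma \<open>num_covering_minor\<close>). So moving a vertex from the larger to the smaller side
  never decreases the number of acyclic orientations as long as the sides do not
  change roles; together with the symmetry in \<open>p\<close> and \<open>q\<close> this gives unimodality, with the peak at
  \<open>k = \<lfloor>n/2\<rfloor>\<close>, and therefore also the maximality of the Turan graph.
\<close>

section \<open>Maps that cover a prescribed set of values\<close>

text \<open>
  The value \<open>z\<close> is the one optional value. It indexes the only block of a side that may be empty:
  the last one for \<open>U\<close> and the first one for \<open>V\<close>.
\<close>
definition covering_maps :: "'a set \<Rightarrow> 'c \<Rightarrow> 'c set \<Rightarrow> ('a \<Rightarrow> 'c) set" where
  "covering_maps U z T = {f \<in> U \<rightarrow>\<^sub>E insert z T. T \<subseteq> f ` U}"

definition num_covering :: "nat \<Rightarrow> nat \<Rightarrow> nat" where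
  "num_covering p m = fact m * Stirling (Suc p) (Suc m)"

lemma num_covering_0: "num_covering 0 m = (if m = 0 then 1 else 0)"
  by (cases m) (simp_all add: num_covering_def)

lemma num_covering_Suc:
  "num_covering (Suc p) m = Suc m * num_covering p m + m * num_covering p (m - 1)"
  by (cases m) (simp_all add: num_covering_def algebra_simps)

lemma finite_covering_maps: "finite U \<Longrightarrow> finite T \<Longrightarrow> finite (covering_maps U z T)"
  unfolding covering_maps_def by (rule finite_subset[of _ "U \<rightarrow>\<^sub>E insert z T"]) (auto intro: finite_PiE)

text \<open>
  The Stirling numbers arise by adding an element \<open>u\<close> to the domain: if \<open>u\<close> is sent to \<open>y\<close>, the
  other elements have to cover all required values except possibly \<open>y\<close>.
\<close>
lemma card_covering_maps:
  assumes "finite U" "finite T" "z \<notin> T"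
  shows "card (covering_maps U z T) = num_covering (card U) (card T)"
  using assms
proof (induction U arbitrary: T rule: finite_induct)
  case empty
  then show ?case by (auto simp: covering_maps_def num_covering_0)
next
  case (insert u U)
  let ?C = "covering_maps U z"
  \<comment> \<open>The possible restrictions to \<open>U\<close> once \<open>u\<close> is sent to \<open>y\<close>.\<close>
  define E where "E y = {f \<in> U \<rightarrow>\<^sub>E insert z T. T - {y} \<subseteq> f ` U}" for y
  have fin: "finite (E y)" for y
    unfolding E_def
    by (rule finite_subset[of _ "U \<rightarrow>\<^sub>E insert z T"]) (use insert in \<open>auto intro: finite_PiE\<close>)
  let ?ext = "\<lambda>(y, f). f(u := y)"
  have "inj_on ?ext (insert z T \<times> (U \<rightarrow>\<^sub>E insert z T))"
    using inj_combinator[of u U "\<lambda>_. insert z T"] insert.hyps by simp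
  then have inj: "inj_on ?ext (Sigma (insert z T) E)"
    by (rule inj_on_subset) (auto simp: E_def)
  have img: "(f(u := y)) ` insert u U = insert y (f ` U)" for f :: "'a \<Rightarrow> 'b" and y
    using insert.hyps by auto
  have "covering_maps (insert u U) z T = ?ext ` Sigma (insert z T) E"
  proof -
    have "f \<in> ?ext ` Sigma (insert z T) E" if "f \<in> covering_maps (insert u U) z T" for f
    proof -
      from that have "f \<in> insert u U \<rightarrow>\<^sub>E insert z T" and c: "T \<subseteq> f ` insert u U"
        by (auto simp: covering_maps_def)
      then obtain y g where y: "y \<in> insert z T" "g \<in> U \<rightarrow>\<^sub>E insert z T" "f = g(u := y)"
        unfolding PiE_insert_eq by auto
      then have "T \<subseteq> insert y (g ` U)" using c img[of g y] by metis
      then have "(y, g) \<in> Sigma (insert z T) E" using y by (auto simp: E_def)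
      then show ?thesis using y(3) by force
    qed
    moreover have "g(u := y) \<in> covering_maps (insert u U) z T"
      if "y \<in> insert z T" "g \<in> E y" for y g
    proof -
      have "g(u := y) \<in> insert u U \<rightarrow>\<^sub>E insert z T"
        unfolding PiE_insert_eq using that by (auto simp: E_def)
      moreover have "T \<subseteq> (g(u := y)) ` insert u U"
        unfolding img using that by (auto simp: E_def)
      ultimately show ?thesis unfolding covering_maps_def by blast
    qed
    ultimately show ?thesis by auto
  qed
  then have "card (covering_maps (insert u U) z T) = card (Sigma (insert z T) E)"
    using inj by (simp add: card_image)
  also have "\<dots> = card (E z) + (\<Sum>y\<in>T. card (E y))"
    using insert.prems fin by simp
  also have "E z = ?C T"
    using insert.prems by (auto simp: E_def covering_maps_def)
  also have "card (?C T) = num_covering (card U) (card T)"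
    using insert by simp
  also have "(\<Sum>y\<in>T. card (E y)) =
    (\<Sum>y\<in>T. num_covering (card U) (card T) + num_covering (card U) (card T - 1))"
  proof (rule sum.cong)
    fix y assume y: "y \<in> T"
    \<comment> \<open>Either \<open>U\<close> reaches \<open>y\<close> as well, or it avoids \<open>y\<close> and so covers one value fewer.\<close>
    have "E y = ?C T \<union> ?C (T - {y})"
      using y insert.prems by (auto simp: E_def covering_maps_def PiE_iff)
    moreover have "?C T \<inter> ?C (T - {y}) = {}"
      using y insert.prems by (auto simp: covering_maps_def PiE_iff)
    ultimately have "card (E y) = card (?C T) + card (?C (T - {y}))"
      using insert by (simp add: card_Un_disjoint finite_covering_maps)
    then show "card (E y) = num_covering (card U) (card T) + num_covering (card U) (card T - 1)"
      using insert y by simp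
  qed simp
  finally show ?case
    using insert.hyps by (simp add: num_covering_Suc algebra_simps)
qed

section \<open>Acyclic orientations of a complete bipartite graph as sequences of blocks\<close>

text \<open>
  The functions \<open>f\<close> and \<open>g\<close> give the block index of the vertices of \<open>U\<close> and \<open>V\<close>. The asymmetry
  between \<open><\<close> and \<open>\<le>\<close> places the block \<open>V\<^sub>j\<close> just before \<open>U\<^sub>j\<close>.
\<close>
definition block_orientation ::
    "'a set \<Rightarrow> 'a set \<Rightarrow> ('a \<Rightarrow> nat) \<Rightarrow> ('a \<Rightarrow> nat) \<Rightarrow> ('a \<times> 'a) set" where
  "block_orientation U V f g =
     {(u, v). u \<in> U \<and> v \<in> V \<and> f u < g v} \<union> {(v, u). v \<in> V \<and> u \<in> U \<and> g v \<le> f u}"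

definition block_ranks :: "'a set \<Rightarrow> 'a set \<Rightarrow> nat \<Rightarrow> (('a \<Rightarrow> nat) \<times> ('a \<Rightarrow> nat)) set" where
  "block_ranks U V m = covering_maps U m {..<m} \<times> covering_maps V 0 {1..m}"

lemma block_ranksD:
  assumes "(f, g) \<in> block_ranks U V m"
  shows "f \<in> extensional U" "g \<in> extensional V"
    and "u \<in> U \<Longrightarrow> f u \<le> m" "v \<in> V \<Longrightarrow> g v \<le> m"
    and "j < m \<Longrightarrow> \<exists>u\<in>U. f u = j" "1 \<le> j \<Longrightarrow> j \<le> m \<Longrightarrow> \<exists>v\<in>V. g v = j"
proof -
  show "f \<in> extensional U" "g \<in> extensional V"
    using assms by (auto simp: block_ranks_def covering_maps_def PiE_iff)
  show "u \<in> U \<Longrightarrow> f u \<le> m" "v \<in> V \<Longrightarrow> g v \<le> m"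
    using assms by (force simp: block_ranks_def covering_maps_def PiE_iff)+
  show "\<exists>u\<in>U. f u = j" if "j < m"
  proof -
    have "j \<in> f ` U" using assms that by (auto simp: block_ranks_def covering_maps_def)
    then show ?thesis by auto
  qed
  show "\<exists>v\<in>V. g v = j" if "1 \<le> j" "j \<le> m"
  proof -
    have "j \<in> g ` V" using assms that by (auto simp: block_ranks_def covering_maps_def)
    then show ?thesis by auto
  qed
qed

text \<open>
  The position in the sequence \<open>V\<^sub>0, U\<^sub>0, V\<^sub>1, U\<^sub>1, \<dots>\<close>, which is \<open>2 g v\<close> for \<open>v \<in> V\<close> and
  \<open>2 f u + 1\<close> for \<open>u \<in> U\<close>, grows along every arc; the proof uses its negative as a potential.
\<close>
lemma acyclic_block_orientation:
  assumes "U \<inter> V = {}"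
  shows "acyclic (block_orientation U V f g)"
proof (rule acyclicI_order)
  fix a b assume "(a, b) \<in> block_orientation U V f g"
  then show "(if b \<in> U then - 2 * int (f b) - 1 else - 2 * int (g b))
    < (if a \<in> U then - 2 * int (f a) - 1 else - 2 * int (g a))"
    using assms by (auto simp: block_orientation_def)
qed

lemma block_orientation_in_acyclic_orientations:
  assumes "U \<inter> V = {}" "arcs_ends G = U \<times> V \<union> V \<times> U"
  shows "block_orientation U V f g \<in> acyclic_orientations G"
  using assms acyclic_block_orientation[OF assms(1)]
  by (auto simp: acyclic_orientations_def orientation_def block_orientation_def)

definition in_nbrs :: "('a \<times> 'a) set \<Rightarrow> 'a \<Rightarrow> 'a set" where
  "in_nbrs A u = {v. (v, u) \<in> A}"

text \<open>
  The number of blocks and the block indices can be read off from the orientation: the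
  in-neighbourhood of a vertex in \<open>U\<^sub>j\<close> is \<open>X j = V\<^sub>0 \<union> \<dots> \<union> V\<^sub>j\<close>, and these sets increase strictly
  with \<open>j\<close>. As \<open>U\<^sub>m\<close> may be empty, \<open>X m = V\<close> need not be an in-neighbourhood, and therefore \<open>V\<close> is
  added to the chain.
\<close>
lemma block_ranks_recovered:
  fixes A
  assumes disj: "U \<inter> V = {}" and fg: "(f, g) \<in> block_ranks U V m"
    and A: "A = block_orientation U V f g"
  defines "C \<equiv> insert V (in_nbrs A ` U)"
  shows "card C = Suc m"
    and "u \<in> U \<Longrightarrow> f u = card {Y \<in> C. Y \<subset> in_nbrs A u}"
    and "v \<in> V \<Longrightarrow> g v = card {Y \<in> C. v \<notin> Y}"
proof -
  define X where "X j = {v \<in> V. g v \<le> j}" for j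
  note D = block_ranksD[OF fg]
  have I: "in_nbrs A u = X (f u)" if "u \<in> U" for u
    using that disj by (auto simp: in_nbrs_def A block_orientation_def X_def)
  have Xm: "X m = V" using D(4) by (auto simp: X_def)
  have X_iff: "X i \<subset> X j \<longleftrightarrow> i < j" if "i \<le> m" "j \<le> m" for i j
  proof
    assume "i < j"
    then obtain v where "v \<in> V" "g v = j" using D(6)[of j] \<open>j \<le> m\<close> by auto
    then have "v \<in> X j" "v \<notin> X i" using \<open>i < j\<close> by (auto simp: X_def)
    moreover have "X i \<subseteq> X j" using \<open>i < j\<close> by (auto simp: X_def)
    ultimately show "X i \<subset> X j" by blast
  next
    assume "X i \<subset> X j"
    then show "i < j" by (rule contrapos_pp) (auto simp: X_def)
  qed
  have inj: "inj_on X {..m}"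
  proof (rule inj_onI)
    fix i j assume "i \<in> {..m}" "j \<in> {..m}" "X i = X j"
    then show "i = j" using X_iff[of i j] X_iff[of j i] by auto
  qed
  have C: "C = X ` {..m}"
  proof -
    have "X j \<in> C" if j: "j \<le> m" for j
    proof (cases "j = m")
      case True then show ?thesis by (simp add: C_def Xm)
    next
      case False
      then obtain u where "u \<in> U" "f u = j" using D(5)[of j] j by auto
      then show ?thesis using I by (auto simp: C_def)
    qed
    moreover have "Y \<in> X ` {..m}" if "Y \<in> C" for Y
      using that I D(3) Xm by (auto simp: C_def)
    ultimately show ?thesis by auto
  qed
  show "card C = Suc m" unfolding C using inj by (simp add: card_image)
  have initial: "card (X ` {..<j}) = j" if "j \<le> m" for j
  proof -
    have "inj_on X {..<j}" using inj that by (auto intro: inj_on_subset)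
    then show ?thesis by (simp add: card_image)
  qed
  show "f u = card {Y \<in> C. Y \<subset> in_nbrs A u}" if "u \<in> U"
  proof -
    have "{Y \<in> C. Y \<subset> in_nbrs A u} = X ` {j. j \<le> m \<and> X j \<subset> X (f u)}"
      unfolding C I[OF that] by blast
    also have "{j. j \<le> m \<and> X j \<subset> X (f u)} = {..<f u}"
    proof -
      have "j \<le> m \<and> X j \<subset> X (f u) \<longleftrightarrow> j < f u" for j
        using X_iff[of j "f u"] D(3)[OF that] by linarith
      then show ?thesis by (simp add: lessThan_def)
    qed
    finally have "{Y \<in> C. Y \<subset> in_nbrs A u} = X ` {..<f u}" .
    then show ?thesis using initial D(3)[OF that] by simp
  qed
  show "g v = card {Y \<in> C. v \<notin> Y}" if "v \<in> V"
  proof -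
    have "{Y \<in> C. v \<notin> Y} = X ` {..<g v}"
      unfolding C using that D(4)[OF that] by (auto simp: X_def)
    then show ?thesis using initial D(4)[OF that] by simp
  qed
qed

lemma block_orientation_inj:
  assumes disj: "U \<inter> V = {}"
    and fg: "(f, g) \<in> block_ranks U V m" and fg': "(f', g') \<in> block_ranks U V m'"
    and eq: "block_orientation U V f g = block_orientation U V f' g'"
  shows "m = m' \<and> f = f' \<and> g = g'"
proof (intro conjI)
  note R = block_ranks_recovered[OF disj fg refl]
  note R' = block_ranks_recovered[OF disj fg' eq]
  show "m = m'" using R(1) R'(1) by simp
  show "f = f'"
    by (rule extensionalityI[OF block_ranksD(1)[OF fg] block_ranksD(1)[OF fg']])
       (metis R(2) R'(2))
  show "g = g'"
    by (rule extensionalityI[OF block_ranksD(2)[OF fg] block_ranksD(2)[OF fg']])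
       (metis R(3) R'(3))
qed

text \<open>
  If \<open>v\<close> and \<open>v'\<close> witness that the in-neighbourhoods of \<open>u\<close> and \<open>u'\<close> are incomparable, then
  \<open>v \<rightarrow> u \<rightarrow> v' \<rightarrow> u' \<rightarrow> v\<close> is a directed cycle.
\<close>
lemma in_nbrs_chain:
  assumes disj: "U \<inter> V = {}" and ends: "arcs_ends G = U \<times> V \<union> V \<times> U"
    and A: "A \<in> acyclic_orientations G" and u: "u \<in> U" "u' \<in> U"
  shows "in_nbrs A u \<subseteq> in_nbrs A u' \<or> in_nbrs A u' \<subseteq> in_nbrs A u"
proof (rule ccontr)
  assume "\<not> ?thesis"
  then obtain v v' where vu: "(v, u) \<in> A" "(v, u') \<notin> A" "(v', u') \<in> A" "(v', u) \<notin> A"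
    by (auto simp: in_nbrs_def)
  have o: "\<And>a b. (a, b) \<in> arcs_ends G \<Longrightarrow> (a, b) \<in> A \<longleftrightarrow> (b, a) \<notin> A" and ac: "acyclic A"
    using A by (auto simp: acyclic_orientations_def orientation_def)
  have "A \<subseteq> arcs_ends G" using A by (auto simp: acyclic_orientations_def orientation_def)
  then have v: "v \<in> V" "v' \<in> V" using vu u disj by (auto simp: ends)
  have "(u, v') \<in> A" "(u', v) \<in> A"
    using o[of u v'] o[of u' v] vu u v by (auto simp: ends)
  with vu have "(v, v) \<in> A\<^sup>+"
    by (meson r_into_trancl trancl_into_trancl)
  with ac show False by (simp add: acyclic_def)
qed

text \<open>On a chain of finite sets, cardinality is a strict order embedding into the naturals.\<close>
lemma finite_chain_enumeration:
  assumes "finite C" "\<And>Y. Y \<in> C \<Longrightarrow> finite Y" "\<And>Y Z. Y \<in> C \<Longrightarrow> Z \<in> C \<Longrightarrow> Y \<subseteq> Z \<or> Z \<subseteq> Y"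
  obtains X where "bij_betw X {..<card C} C"
    and "\<And>i j. i < card C \<Longrightarrow> j < card C \<Longrightarrow> X i \<subset> X j \<longleftrightarrow> i < j"
proof -
  have sub_iff: "Y \<subset> Z \<longleftrightarrow> card Y < card Z" if "Y \<in> C" "Z \<in> C" for Y Z
    using assms(2,3) that by (metis card_mono linorder_not_less psubset_card_mono psubsetI)
  have inj: "inj_on card C"
  proof (rule inj_onI)
    fix Y Z assume "Y \<in> C" "Z \<in> C" "card Y = card Z"
    then show "Y = Z" using assms(3)[of Y Z] sub_iff[of Y Z] sub_iff[of Z Y] by auto
  qed
  have cc: "card (card ` C) = card C" using inj by (rule card_image)
  obtain h where h: "bij_betw h {..<card C} (card ` C)" "strict_mono_on {..<card C} h"
    using ex_bij_betw_strict_mono_card[of "card ` C"] assms(1) unfolding cc by auto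
  define X where "X = inv_into C card \<circ> h"
  have b: "bij_betw X {..<card C} C"
    unfolding X_def by (rule bij_betw_trans[OF h(1)])
      (simp add: bij_betw_inv_into inj inj_on_imp_bij_betw)
  have cX: "card (X i) = h i" if "i < card C" for i
    using h(1) that by (auto simp: X_def bij_betw_def intro!: f_inv_into_f)
  have "X i \<subset> X j \<longleftrightarrow> i < j" if "i < card C" "j < card C" for i j
  proof -
    have "X i \<in> C" "X j \<in> C" using b that by (auto simp: bij_betw_def)
    then have "X i \<subset> X j \<longleftrightarrow> h i < h j" by (simp add: sub_iff cX that)
    also have "\<dots> \<longleftrightarrow> i < j"
      using h(2) that by (simp add: strict_mono_on_less)
    finally show ?thesis .
  qed
  with b show thesis by (rule that)
qed

text \<open>
  The converse of the construction of block orientations: enumerate the chain of in-neighbourhoods,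
  completed by \<open>V\<close>, as \<open>X 0 \<subset> \<dots> \<subset> X m = V\<close>. A vertex \<open>u\<close> gets the index of its in-neighbourhood,
  a vertex \<open>v\<close> the index of the first member of the chain that contains it. Each \<open>X j\<close> with
  \<open>j < m\<close> is an in-neighbourhood, and each \<open>X j - X (j - 1)\<close> is nonempty, which gives the
  covering conditions.
\<close>
lemma acyclic_orientation_is_block_orientation:
  assumes fin: "finite U" "finite V" and disj: "U \<inter> V = {}"
    and ends: "arcs_ends G = U \<times> V \<union> V \<times> U" and A: "A \<in> acyclic_orientations G"
  obtains m f g where "(f, g) \<in> block_ranks U V m" "A = block_orientation U V f g"
proof -
  have AE: "A \<subseteq> arcs_ends G"
    and o: "\<And>a b. (a, b) \<in> arcs_ends G \<Longrightarrow> (a, b) \<in> A \<longleftrightarrow> (b, a) \<notin> A"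
    using A by (auto simp: acyclic_orientations_def orientation_def)
  have IV: "in_nbrs A u \<subseteq> V" if "u \<in> U" for u
    using AE disj that by (auto simp: ends in_nbrs_def)
  define C where "C = insert V (in_nbrs A ` U)"
  have CV: "Y \<subseteq> V" if "Y \<in> C" for Y using that IV by (auto simp: C_def)
  have "Y \<subseteq> Z \<or> Z \<subseteq> Y" if "Y \<in> C" "Z \<in> C" for Y Z
    using that IV in_nbrs_chain[OF disj ends A] unfolding C_def by blast
  moreover have finC: "finite C" and "\<And>Y. Y \<in> C \<Longrightarrow> finite Y"
    using fin CV by (auto simp: C_def intro: finite_subset)
  ultimately obtain X where bij: "bij_betw X {..<card C} C"
    and X_iff: "\<And>i j. i < card C \<Longrightarrow> j < card C \<Longrightarrow> X i \<subset> X j \<longleftrightarrow> i < j"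
    using finite_chain_enumeration[of C] by metis
  define m where "m = card C - 1"
  have cardC: "card C = Suc m"
    using finC by (simp add: m_def C_def card_gt_0_iff)
  have XC: "X j \<in> C" if "j \<le> m" for j
    using bij that by (auto simp: bij_betw_def cardC)
  have ex: "\<exists>j\<le>m. Y = X j" if "Y \<in> C" for Y
    using bij that by (auto simp: bij_betw_def cardC less_Suc_eq_le)
  have X_mono: "X i \<subseteq> X j" if "i \<le> j" "j \<le> m" for i j
    using X_iff[of i j] that by (cases "i = j") (auto simp: cardC)
  have Xm: "X m = V"
  proof -
    obtain j where "j \<le> m" "V = X j" using ex[of V] by (auto simp: C_def)
    then have "V \<subseteq> X m" using X_mono[of j m] by simp
    then show ?thesis using CV[OF XC[of m]] by auto
  qed
  define f where "f = (\<lambda>u\<in>U. SOME j. j \<le> m \<and> in_nbrs A u = X j)"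
  define g where "g = (\<lambda>v\<in>V. LEAST j. v \<in> X j)"
  have f: "f u \<le> m \<and> in_nbrs A u = X (f u)" if "u \<in> U" for u
  proof -
    have "\<exists>j. j \<le> m \<and> in_nbrs A u = X j" using ex[of "in_nbrs A u"] that by (auto simp: C_def)
    then show ?thesis using someI_ex[of "\<lambda>j. j \<le> m \<and> in_nbrs A u = X j"] that by (simp add: f_def)
  qed
  have g: "v \<in> X j \<longleftrightarrow> g v \<le> j" if "v \<in> V" "j \<le> m" for v j
  proof
    assume "v \<in> X j"
    then show "g v \<le> j" using that by (simp add: g_def Least_le)
  next
    assume le: "g v \<le> j"
    have "v \<in> X (g v)" using LeastI[of "\<lambda>j. v \<in> X j" m] Xm that by (simp add: g_def)
    then show "v \<in> X j" using X_mono[OF le that(2)] by auto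
  qed
  have gm: "g v \<le> m" if "v \<in> V" for v using g[OF that, of m] Xm that by simp
  have "f \<in> covering_maps U m {..<m}"
  proof -
    have "j \<in> f ` U" if j: "j < m" for j
    proof -
      have "X j \<noteq> V" using X_iff[of j m] j Xm by (auto simp: cardC)
      then obtain u where u: "u \<in> U" "X j = in_nbrs A u"
        using XC[of j] j by (auto simp: C_def)
      then have "X (f u) = X j" using f by simp
      then have "f u = j" using bij f[OF u(1)] j by (auto simp: bij_betw_def inj_on_def cardC)
      then show ?thesis using u(1) by auto
    qed
    moreover have "f \<in> U \<rightarrow>\<^sub>E insert m {..<m}"
      using f by (fastforce simp: PiE_iff f_def extensional_def)
    ultimately show ?thesis by (auto simp: covering_maps_def)
  qed
  moreover have "g \<in> covering_maps V 0 {1..m}"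
  proof -
    have "j \<in> g ` V" if j: "1 \<le> j" "j \<le> m" for j
    proof -
      have "X (j - 1) \<subset> X j" using X_iff[of "j - 1" j] j by (auto simp: cardC)
      then obtain v where v: "v \<in> X j" "v \<notin> X (j - 1)" by auto
      then have "v \<in> V" using CV[OF XC[of j]] j by auto
      then have "g v = j" using g[of v j] g[of v "j - 1"] v j by auto
      then show ?thesis using \<open>v \<in> V\<close> by auto
    qed
    moreover have "g \<in> V \<rightarrow>\<^sub>E insert 0 {1..m}"
      using gm by (fastforce simp: PiE_iff g_def extensional_def)
    ultimately show ?thesis by (auto simp: covering_maps_def)
  qed
  ultimately have ranks: "(f, g) \<in> block_ranks U V m" by (simp add: block_ranks_def)
  have vu: "(v, u) \<in> A \<longleftrightarrow> g v \<le> f u" if "u \<in> U" "v \<in> V" for u v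
    using f[OF that(1)] g[OF that(2), of "f u"] by (auto simp: in_nbrs_def)
  have uv: "(u, v) \<in> A \<longleftrightarrow> f u < g v" if "u \<in> U" "v \<in> V" for u v
    using o[of u v] vu[OF that] that by (auto simp: ends)
  have "A = block_orientation U V f g"
  proof (rule set_eqI, clarify)
    fix a b
    show "(a, b) \<in> A \<longleftrightarrow> (a, b) \<in> block_orientation U V f g"
      using AE uv vu disj by (auto simp: block_orientation_def ends)
  qed
  with ranks show thesis by (rule that)
qed

lemma num_acyclic_orientations_bipartite:
  assumes fin: "finite U" "finite V" and disj: "U \<inter> V = {}"
    and ends: "arcs_ends G = U \<times> V \<union> V \<times> U" and N: "card U \<le> N"
  shows "num_acyclic_orientations G =
    (\<Sum>m\<le>N. num_covering (card U) m * num_covering (card V) m)"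
proof -
  let ?F = "\<lambda>(m :: nat, f, g). block_orientation U V f g"
  let ?S = "Sigma {..N} (block_ranks U V)"
  have "inj_on ?F ?S"
    using block_orientation_inj[OF disj] by (fastforce intro!: inj_onI)
  moreover have "acyclic_orientations G = ?F ` ?S"
  proof
    show "?F ` ?S \<subseteq> acyclic_orientations G"
      using block_orientation_in_acyclic_orientations[OF disj ends] by auto
    show "acyclic_orientations G \<subseteq> ?F ` ?S"
    proof
      fix A assume "A \<in> acyclic_orientations G"
      then obtain m f g where fg: "(f, g) \<in> block_ranks U V m" "A = block_orientation U V f g"
        using acyclic_orientation_is_block_orientation[OF fin disj ends] by metis
      have "{..<m} \<subseteq> f ` U" using fg(1) by (simp add: block_ranks_def covering_maps_def)
      then have "m \<le> card U" using surj_card_le[OF fin(1)] by fastforce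
      then show "A \<in> ?F ` ?S" using fg N by (force intro!: image_eqI[of _ _ "(m, f, g)"])
    qed
  qed
  ultimately have "num_acyclic_orientations G = card ?S"
    by (simp add: num_acyclic_orientations_def card_image)
  also have "\<dots> = (\<Sum>m\<le>N. card (block_ranks U V m))"
    using fin by (intro card_SigmaI) (auto simp: block_ranks_def finite_covering_maps)
  also have "\<dots> = (\<Sum>m\<le>N. num_covering (card U) m * num_covering (card V) m)"
    using fin by (simp add: block_ranks_def card_cartesian_product card_covering_maps)
  finally show ?thesis .
qed

section \<open>Total positivity and comparison of neighbouring parameters\<close>

text \<open>
  All terms with \<open>m > min p q\<close> vanish. The bound \<open>p + q\<close> is symmetric and is constant
  when a vertex moves from one side to the other, so sums for different parameters can be compared
  term by term.
\<close>
definition acyclic_count :: "nat \<Rightarrow> nat \<Rightarrow> nat" where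
  "acyclic_count p q = (\<Sum>m\<le>p + q. num_covering p m * num_covering q m)"

lemma num_acyclic_orientations_complete_bipartite:
  assumes "complete_bipartite_digraph p q G"
  shows "num_acyclic_orientations G = acyclic_count p q"
proof -
  obtain U V where UV: "verts G = U \<union> V" "U \<inter> V = {}" "card U = p" "card V = q"
      "arcs_ends G = U \<times> V \<union> V \<times> U" and "graph G"
    using assms by (auto simp: complete_bipartite_digraph_def)
  interpret graph G by fact
  have "finite U" "finite V" using finite_verts UV(1) by auto
  then show ?thesis
    using num_acyclic_orientations_bipartite[OF _ _ UV(2,5), of "p + q"] UV(3,4)
    by (simp add: acyclic_count_def)
qed

lemma acyclic_count_commute: "acyclic_count p q = acyclic_count q p"
  by (simp add: acyclic_count_def add.commute mult.commute)

text \<open>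
  The step from row \<open>p\<close> to row \<open>p + 1\<close> is multiplication by a bidiagonal matrix with nonnegative
  entries, so each 2x2 minor of the rows \<open>p + 1\<close> and \<open>r + 1\<close> is a nonnegative combination of
  minors of the rows \<open>p\<close> and \<open>r\<close> (Cauchy-Binet). Adjacent columns alone would not
  be closed under this expansion, which involves the columns \<open>i - 1\<close> and \<open>j\<close>. The minor in the
  columns \<open>i\<close> and \<open>j - 1\<close> is zero if these coincide.
\<close>
lemma num_covering_minor:
  assumes "p \<le> r" "i < j"
  shows "num_covering p j * num_covering r i \<le> num_covering p i * num_covering r j"
  using assms
proof (induction p arbitrary: r i j)
  case 0
  then show ?case by (simp add: num_covering_0)
next
  case (Suc p)
  from Suc.prems obtain s where r: "r = Suc s" "p \<le> s" by (cases r) auto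
  let ?a = "num_covering p" and ?b = "num_covering s"
  have IH: "?a j' * ?b i' \<le> ?a i' * ?b j'" if "i' \<le> j'" for i' j'
    using Suc.IH[OF r(2), of i' j'] that by (cases "i' = j'") auto
  have "Suc i * Suc j * (?a j * ?b i) \<le> Suc i * Suc j * (?a i * ?b j)"
    "Suc i * j * (?a (j - 1) * ?b i) \<le> Suc i * j * (?a i * ?b (j - 1))"
    "i * Suc j * (?a j * ?b (i - 1)) \<le> i * Suc j * (?a (i - 1) * ?b j)"
    "i * j * (?a (j - 1) * ?b (i - 1)) \<le> i * j * (?a (i - 1) * ?b (j - 1))"
    using Suc.prems by (intro mult_le_mono2 IH; simp)+
  then have "Suc i * Suc j * (?a j * ?b i) + Suc i * j * (?a (j - 1) * ?b i)
      + i * Suc j * (?a j * ?b (i - 1)) + i * j * (?a (j - 1) * ?b (i - 1))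
    \<le> Suc i * Suc j * (?a i * ?b j) + Suc i * j * (?a i * ?b (j - 1))
      + i * Suc j * (?a (i - 1) * ?b j) + i * j * (?a (i - 1) * ?b (j - 1))"
    by (intro add_mono)
  then show ?case
    unfolding r num_covering_Suc by (simp only: algebra_simps)
qed

text \<open>
  Expanding the row \<open>q + 1\<close> on the left and the row \<open>p + 1\<close> on the right by the recurrence, the
  terms \<open>(m + 1) * num_covering p m * num_covering q m\<close> agree, and the rest is a
  minor in the columns \<open>m - 1\<close> and \<open>m\<close>.
\<close>
lemma acyclic_count_shift:
  assumes "p \<le> q"
  shows "acyclic_count p (Suc q) \<le> acyclic_count (Suc p) q"
proof -
  let ?a = "num_covering p" and ?b = "num_covering q"
  have "?a m * num_covering (Suc q) m \<le> num_covering (Suc p) m * ?b m" for m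
  proof -
    have "m * (?a m * ?b (m - 1)) \<le> m * (?a (m - 1) * ?b m)"
      using num_covering_minor[OF assms, of "m - 1" m] by (cases "m = 0") (auto intro!: mult_le_mono2)
    then show ?thesis by (simp add: num_covering_Suc algebra_simps)
  qed
  then show ?thesis
    unfolding acyclic_count_def add_Suc add_Suc_right by (rule sum_mono)
qed

section \<open>Unimodality and the maximum\<close>

lemma acyclic_count_up:
  assumes "i < n div 2"
  shows "acyclic_count i (n - i) \<le> acyclic_count (Suc i) (n - Suc i)"
proof -
  have "n - i = Suc (n - Suc i)" "i \<le> n - Suc i" using assms by auto
  then show ?thesis using acyclic_count_shift[of i "n - Suc i"] by simp
qed

lemma acyclic_count_down:
  assumes "n div 2 \<le> i" "i < n"
  shows "acyclic_count (Suc i) (n - Suc i) \<le> acyclic_count i (n - i)"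
proof -
  have "n - i = Suc (n - Suc i)" "n - Suc i \<le> i" using assms by auto
  then show ?thesis
    using acyclic_count_shift[of "n - Suc i" i] by (simp add: acyclic_count_commute)
qed

lemma acyclic_count_le_balanced:
  assumes "i \<le> n"
  shows "acyclic_count i (n - i) \<le> acyclic_count (n div 2) (n - n div 2)"
proof (cases "i \<le> n div 2")
  case True
  then show ?thesis
  proof (induction i rule: inc_induct)
    case (step i)
    then show ?case using acyclic_count_up[of i n] by simp
  qed simp
next
  case False
  then have "n div 2 \<le> i" by simp
  then show ?thesis using assms
  proof (induction i rule: dec_induct)
    case (step i)
    then show ?case using acyclic_count_down[of n i] by simp
  qed simp
qed

lemma turan2_eq: "turan2 n = K_bip (n div 2) (n - n div 2)"
proof -
  have "\<lfloor>real n / 2\<rfloor> = int (n div 2)" by linarith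
  moreover have "\<lceil>real n / 2\<rceil> = int (n - n div 2)" by linarith
  ultimately show ?thesis by (simp only: turan2_def nat_int)
qed

theorem theorem3p6:
  fixes n :: nat
  assumes "2 \<le> n"
  shows "(\<exists>n\<^sub>1 n\<^sub>2. n\<^sub>1 + n\<^sub>2 = n \<and> \<bar>int n\<^sub>1 - int n\<^sub>2\<bar> \<le> 1 \<and> turan2 n = K_bip n\<^sub>1 n\<^sub>2) \<and>
    complete_bipartite_on n (turan2 n) \<and>
    (\<forall>G :: ('a, 'b) pre_digraph. complete_bipartite_on n G \<longrightarrow>
       num_acyclic_orientations G \<le> num_acyclic_orientations (turan2 n)) \<and>
    unimodal_on 1 (n - 1) (\<lambda>k. num_acyclic_orientations (K_bip k (n - k)))"
proof (intro conjI allI impI)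
  note count_K_bip = num_acyclic_orientations_complete_bipartite[OF complete_bipartite_K_bip]
  show "\<exists>n\<^sub>1 n\<^sub>2. n\<^sub>1 + n\<^sub>2 = n \<and> \<bar>int n\<^sub>1 - int n\<^sub>2\<bar> \<le> 1 \<and> turan2 n = K_bip n\<^sub>1 n\<^sub>2"
    by (intro exI[of _ "n div 2"] exI[of _ "n - n div 2"]) (auto simp: turan2_eq)
  have "1 \<le> n div 2" "1 \<le> n - n div 2" "n div 2 + (n - n div 2) = n" using assms by auto
  then show "complete_bipartite_on n (turan2 n)"
    unfolding complete_bipartite_on_def turan2_eq using complete_bipartite_K_bip by blast
  show "num_acyclic_orientations G \<le> num_acyclic_orientations (turan2 n)"
    if G: "complete_bipartite_on n G" for G :: "('a, 'b) pre_digraph"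
  proof -
    obtain p q where "p + q = n" "complete_bipartite_digraph p q G"
      using G by (auto simp: complete_bipartite_on_def)
    then show ?thesis
      using acyclic_count_le_balanced[of p n]
      by (auto simp: turan2_eq count_K_bip num_acyclic_orientations_complete_bipartite)
  qed
  show "unimodal_on 1 (n - 1) (\<lambda>k. num_acyclic_orientations (K_bip k (n - k)))"
    unfolding unimodal_on_def count_K_bip
    using assms acyclic_count_up[of _ n] acyclic_count_down[of n]
    by (intro exI[of _ "n div 2"]) auto
qed

end
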